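(* Consider the linear time-invariant system with state matrix $\mathbf A\in\mathbb R^{n\times n}$, output matrix $\mathbf C\in\mathbb R^{p\times n}$, $(\mathbf A,\mathbf C)$ observable, and steady-state Kalman gain $\mathbf K$, with an arbitrary set $\mathcal K\subseteq\{1,\dots,p\}$ of compromised sensors, and a global intermittent data integrity enforcement policy $(\mu,f,L)$ with $f=\min(\psi,q_{un})$ and $L$ finite, where $\psi$ is the observability index of $(\mathbf A,\mathbf C)$ and $q_{un}$ is the number of unstable eigenvalues of $\mathbf A$. Then the system is not perfectly attackable.
   Context: Plant: $\mathbf x_{k+1}=\mathbf A\mathbf x_k+\mathbf B\mathbf u_k+\mathbf w_k$, $\mathbf y_k=\mathbf C\mathbf x_k+\mathbf v_k$, with independent Gaussian $\mathbf x_0,\mathbf w_k,\mathbf v_k$; a steady-state Kalman filter with gain $\mathbf K=\mathbf\Sigma\mathbf C^T(\mathbf C\mathbf\Sigma\mathbf C^T+\mathbf R)^{-1}$ is used ($\mathbf\Sigma$ the estimation error covariance, $\mathbf R$ the measurement noise covariance). An attacker adds $\mathbf a_k\in\mathbb R^p$ to the measurements at times $k\ge1$, with $\mathrm{supp}(\mathbf a_k)\subseteq\mathcal K$. The attack-induced changes $\Delta\mathbf e_k$ of the estimation error and $\Delta\mathbf z_k$ of the residue satisfy the deterministic dynamics $\Delta\mathbf e_0=\mathbf 0$, $$\Delta\mathbf e_{k+1}=(\mathbf A-\mathbf K\mathbf C\mathbf A)\Delta\mathbf e_k-\mathbf K\mathbf a_{k+1},\qquad \Delta\mathbf z_{k}=\mathbf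 C\mathbf A\Delta\mathbf e_{k-1}+\mathbf a_{k}.$$ The estimation error under attack $\mathbf e_k^a$ has mean $E[\mathbf e_k^a]=\Delta\mathbf e_k$ and covariance $\mathbf\Sigma$. Stealthiness (normalized form): $\mathcal A_k$ is the set of attacks $\mathbf a_{1..k}=(\mathbf a_1,\dots,\mathbf a_k)$ (obeying the support and integrity constraints) with $\|\Delta\mathbf z_{k'}\|_2\le1$ for all $1\le k'\le k$. Reachable region: for a fixed design parameter $\gamma\ge0$, $\mathcal R_k=\{\mathbf e\in\mathbb R^n:\ \mathbf e\mathbf e^T\preccurlyeq \Delta\mathbf e_k\Delta\mathbf e_k^T+\gamma\mathbf\Sigma\text{ for the }\Delta\mathbf e_k\text{ produced by some }\mathbf a_{1..k}\in\mathcal A_k\}$ and $\mathcal R=\bigcup_{k\ge1}\mathcal R_k$. The system is perfectly attackable if $\mathcal R$ is unbounded. Global policy $(\mu,f,L)$: $\mu=\{t_k\}_{k=0}^\infty$ is a strictly increasing sequence of integers with $t_0>1$, $L=\sup_{k>0}(t_k-t_{k-1})$, and the policy forces $\mathbf a_{t_k}=\mathbf a_{t_k+1}=\dots=\mathbf a_{t_k+f-1}=\mathbf 0$ for all $k\ge0$ (for $f=0$ nothing is enforced). An eigenvalue $\lambda$ is unstable if $|\lambda|\ge1$; eigenvalues are counted with algebraic multiplicity. The observability index $\psi$ is the least integer $s$ such that the matrix with block rows $\mathbf C,\mathbf C\mathbf A,\dots,\mathbf C\mathbf A^{s-1}$ has rank $n$. *)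

theory Defs
  imports
    "HOL-Analysis.Analysis"
    "HOL-Computational_Algebra.Polynomial"
    "HOL-Library.Extended_Nat"
begin

section \<open>Matrices\<close>

text \<open>The overloaded \<open>^\<close> and \<open>*\<close> on \<^typ>\<open>real^'n^'n\<close> are componentwise, so powers with respect
  to \<open>**\<close> are defined separately.\<close>

primrec mat_pow :: "real^'n^'n \<Rightarrow> nat \<Rightarrow> real^'n^'n" where
  "mat_pow A 0 = mat 1"
| "mat_pow A (Suc k) = A ** mat_pow A k"

definition pos_semidef :: "real^'n^'n \<Rightarrow> bool" where
  "pos_semidef M \<longleftrightarrow> transpose M = M \<and> (\<forall>x. 0 \<le> x \<bullet> (M *v x))"

definition loewner_le :: "real^'n^'n \<Rightarrow> real^'n^'n \<Rightarrow> bool"  (infix "\<preceq>\<^sub>L" 50) where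
  "M \<preceq>\<^sub>L N \<longleftrightarrow> pos_semidef (N - M)"

definition outer :: "real^'n \<Rightarrow> real^'n^'n" where
  "outer e = (columnvector e :: real^1^'n) ** (rowvector e :: real^'n^1)"

definition char_polynomial :: "real^'n^'n \<Rightarrow> complex poly" where
  "char_polynomial A =
     det ((\<chi> i j. (if i = j then [:0, 1:] else 0) - [:complex_of_real (A $ i $ j):]) :: complex poly^'n^'n)"

definition num_unstable_eigenvalues :: "real^'n^'n \<Rightarrow> nat" where
  "num_unstable_eigenvalues A =
     (\<Sum>z | poly (char_polynomial A) z = 0 \<and> 1 \<le> cmod z. order z (char_polynomial A))"

section \<open>Observability\<close>

text \<open>Rank of the matrix with block rows \<open>C, CA, \<dots>, CA\<^sup>s\<^sup>-\<^sup>1\<close>. Its number of rows depends on \<open>s\<close>, so it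
  is not a typed matrix; as in the library definition of \<open>rank\<close>, the rank is the dimension of the set of rows.\<close>

definition observability_rank :: "real^'n^'n \<Rightarrow> real^'n^'p \<Rightarrow> nat \<Rightarrow> nat" where
  "observability_rank A C s = dim (\<Union>j<s. rows (C ** mat_pow A j))"

definition observable :: "real^'n^'n \<Rightarrow> real^'n^'p \<Rightarrow> bool" where
  "observable (A :: real^'n^'n) C \<longleftrightarrow> observability_rank A C CARD('n) = CARD('n)"

definition observability_index :: "real^'n^'n \<Rightarrow> real^'n^'p \<Rightarrow> nat" where
  "observability_index (A :: real^'n^'n) C = (LEAST s. observability_rank A C s = CARD('n))"

section \<open>Steady-state Kalman filter\<close>

definition kalman_gain :: "real^'n^'p \<Rightarrow> real^'p^'p \<Rightarrow> real^'n^'n \<Rightarrow> real^'p^'n" where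
  "kalman_gain C R \<Sigma> = \<Sigma> ** transpose C ** matrix_inv (C ** \<Sigma> ** transpose C + R)"

text \<open>\<open>Q\<close> and \<open>R\<close> are the covariances of the process and measurement noise. With this formula for the
  gain, \<open>\<Sigma>\<close> is the error covariance of the one-step prediction; steady state means that it is
  a fixed point of a measurement update followed by a time update (the discrete algebraic Riccati
  equation). \<open>R\<close> may be singular; only the innovation covariance has to be invertible.\<close>

definition steady_state_kalman ::
    "real^'n^'n \<Rightarrow> real^'n^'p \<Rightarrow> real^'n^'n \<Rightarrow> real^'p^'p \<Rightarrow> real^'n^'n \<Rightarrow> bool" where
  "steady_state_kalman A C Q R \<Sigma> \<longleftrightarrow>
     pos_semidef Q \<and> pos_semidef R \<and> pos_semidef \<Sigma> \<and>
     invertible (C ** \<Sigma> ** transpose C + R) \<and>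
     \<Sigma> = A ** (\<Sigma> - kalman_gain C R \<Sigma> ** C ** \<Sigma>) ** transpose A + Q"

section \<open>Attacks, integrity enforcement and reachable region\<close>

text \<open>An attack is a function on all times, of which only the values at times \<open>k \<ge> 1\<close> matter.\<close>

primrec error_change ::
    "real^'n^'n \<Rightarrow> real^'n^'p \<Rightarrow> real^'p^'n \<Rightarrow> (nat \<Rightarrow> real^'p) \<Rightarrow> nat \<Rightarrow> real^'n" where
  "error_change A C K a 0 = 0"
| "error_change A C K a (Suc k) = (A - K ** C ** A) *v error_change A C K a k - K *v a (Suc k)"

text \<open>Meaningful for \<open>k \<ge> 1\<close> only.\<close>

definition residue_change ::
    "real^'n^'n \<Rightarrow> real^'n^'p \<Rightarrow> real^'p^'n \<Rightarrow> (nat \<Rightarrow> real^'p) \<Rightarrow> nat \<Rightarrow> real^'p" where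
  "residue_change A C K a k = (C ** A) *v error_change A C K a (k - 1) + a k"

text \<open>A policy is a triple \<open>(\<mu>, f, L)\<close>: \<open>\<mu>\<close> lists the starting times of enforcement, \<open>f\<close> (an arbitrary
  natural number, used in \<open>enforced_times\<close>) is the block length, and \<open>L\<close> is determined by \<open>\<mu>\<close>;
  it is \<open>\<infinity>\<close> if the gaps are unbounded.\<close>

definition policy_schedule :: "(nat \<Rightarrow> nat) \<Rightarrow> enat \<Rightarrow> bool" where
  "policy_schedule \<mu> L \<longleftrightarrow>
     strict_mono \<mu> \<and> 1 < \<mu> 0 \<and> L = (SUP k\<in>{0<..}. enat (\<mu> k - \<mu> (k - 1)))"

definition enforced_times :: "(nat \<Rightarrow> nat) \<Rightarrow> nat \<Rightarrow> nat set" where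
  "enforced_times \<mu> f = {\<mu> k + j | k j. j < f}"

definition stealthy_attacks ::
    "real^'n^'n \<Rightarrow> real^'n^'p \<Rightarrow> real^'p^'n \<Rightarrow> 'p set \<Rightarrow> (nat \<Rightarrow> nat) \<Rightarrow> nat \<Rightarrow> nat
      \<Rightarrow> (nat \<Rightarrow> real^'p) set" where
  "stealthy_attacks A C K \<K> \<mu> f k =
     {a. \<forall>k'\<in>{1..k}. {i. a k' $ i \<noteq> 0} \<subseteq> \<K> \<and>
                      (k' \<in> enforced_times \<mu> f \<longrightarrow> a k' = 0) \<and>
                      norm (residue_change A C K a k') \<le> 1}"

definition reachable_at ::
    "real^'n^'n \<Rightarrow> real^'n^'p \<Rightarrow> real^'p^'n \<Rightarrow> real^'n^'n \<Rightarrow> real \<Rightarrow> 'p set \<Rightarrow> (nat \<Rightarrow> nat) \<Rightarrow> nat \<Rightarrow> nat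
      \<Rightarrow> (real^'n) set" where
  "reachable_at A C K \<Sigma> \<gamma> \<K> \<mu> f k =
     {e. \<exists>a\<in>stealthy_attacks A C K \<K> \<mu> f k.
           outer e \<preceq>\<^sub>L outer (error_change A C K a k) + \<gamma> *\<^sub>R \<Sigma>}"

definition reachable_region ::
    "real^'n^'n \<Rightarrow> real^'n^'p \<Rightarrow> real^'p^'n \<Rightarrow> real^'n^'n \<Rightarrow> real \<Rightarrow> 'p set \<Rightarrow> (nat \<Rightarrow> nat) \<Rightarrow> nat
      \<Rightarrow> (real^'n) set" where
  "reachable_region A C K \<Sigma> \<gamma> \<K> \<mu> f = (\<Union>k\<in>{1..}. reachable_at A C K \<Sigma> \<gamma> \<K> \<mu> f k)"

definition perfectly_attackable ::
    "real^'n^'n \<Rightarrow> real^'n^'p \<Rightarrow> real^'p^'n \<Rightarrow> real^'n^'n \<Rightarrow> real \<Rightarrow> 'p set \<Rightarrow> (nat \<Rightarrow> nat) \<Rightarrow> nat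
      \<Rightarrow> bool" where
  "perfectly_attackable A C K \<Sigma> \<gamma> \<K> \<mu> f \<longleftrightarrow> \<not> bounded (reachable_region A C K \<Sigma> \<gamma> \<K> \<mu> f)"

end

theory Submission
  imports Defs "HOL-Computational_Algebra.Fundamental_Theorem_Algebra"
begin

text \<open>A stealthy attack has residues bounded by \<open>1\<close>, so \<open>\<Delta>e\<close> evolves by \<open>A\<close> up to a bounded input. Split the
  characteristic polynomial of \<open>A\<close> into a stable factor \<open>s\<close> and an unstable factor \<open>u\<close>. By
  Cayley--Hamilton, \<open>s(A)\<close> annihilates \<open>u(A) \<Delta>e\<close>, hence \<open>u(A) \<Delta>e\<close> is bounded regardless of enforcement.
  During an enforcement block starting at time \<open>t\<close> the residues equal \<open>C A \<Delta>e\<close>, which bounds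
  \<open>C A\<^sup>i (A v)\<close> for \<open>i < f\<close> and \<open>v = \<Delta>e\<close> at time \<open>t - 1\<close>. If \<open>f\<close> is the observability index, this bounds \<open>A v\<close>.
  If \<open>f = deg u\<close>, division by \<open>u\<close> extends the bound to all powers \<open>i\<close>, and again \<open>A v\<close> is bounded.
  Bounded gaps between the blocks bound \<open>\<Delta>e\<close> at all times.\<close>

section \<open>Polynomials acting through a matrix\<close>

text \<open>This is \<open>p(T) v\<close>. Complex scalars are used because there the characteristic
  polynomial splits into linear factors.\<close>

definition poly_act :: "complex^'n^'n \<Rightarrow> complex poly \<Rightarrow> complex^'n \<Rightarrow> complex^'n" where
  "poly_act T p v = (\<Sum>i\<le>degree p. coeff p i *s ((*v) T ^^ i) v)"

lemma poly_act_0 [simp]: "poly_act T 0 v = 0"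
  by (simp add: poly_act_def)

lemma poly_act_pCons [simp]: "poly_act T (pCons a p) v = a *s v + T *v poly_act T p v"
proof (cases "p = 0")
  case False
  have "poly_act T (pCons a p) v = a *s v + (\<Sum>i\<le>degree p. coeff p i *s ((*v) T ^^ Suc i) v)"
    using False unfolding poly_act_def
    by (simp del: funpow.simps sum.atMost_Suc add: degree_pCons_eq sum.atMost_Suc_shift)
  also have "\<dots> = a *s v + T *v poly_act T p v"
    by (simp add: poly_act_def vec.linear_sum[OF matrix_vector_mul_linear_gen] vector_scalar_commute)
  finally show ?thesis .
qed (simp add: poly_act_def)

lemma poly_act_add: "poly_act T (p + q) v = poly_act T p v + poly_act T q v"
  by (induction p q rule: poly_induct2)
    (simp_all add: vector_sadd_rdistrib matrix_vector_right_distrib)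

lemma poly_act_smult: "poly_act T (smult c p) v = c *s poly_act T p v"
  by (induction p) (simp_all add: vector_smult_assoc vector_add_ldistrib vector_scalar_commute)

lemma poly_act_diff: "poly_act T (p - q) v = poly_act T p v - poly_act T q v"
  using poly_act_add[of T "p - q" q v] by simp

lemma poly_act_sum: "poly_act T (\<Sum>i\<in>I. p i) v = (\<Sum>i\<in>I. poly_act T (p i) v)"
  by (induction I rule: infinite_finite_induct) (simp_all add: poly_act_add)

lemma poly_act_mult: "poly_act T (p * q) v = poly_act T p (poly_act T q v)"
  by (induction p) (simp_all add: poly_act_add poly_act_smult)

lemma poly_act_monom: "poly_act T (monom c i) v = c *s ((*v) T ^^ i) v"
  by (induction i) (simp_all add: monom_0 monom_Suc vector_scalar_commute)

lemma linear_poly_act: "Vector_Spaces.linear (*s) (*s) (poly_act T p)"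
proof (induction p)
  case 0
  show ?case by (simp add: vec.linear_0 Vector_Spaces.linear_iff vec.vector_space_axioms)
next
  case (pCons a p)
  show ?case
    using pCons.IH by (simp add: Vector_Spaces.linear_iff vector_add_ldistrib
        matrix_vector_right_distrib vector_scalar_commute vector_smult_assoc mult.commute)
qed

lemma bounded_linear_poly_act: "bounded_linear (poly_act T p)"
proof -
  have "linear (poly_act T p)"
    using linear_poly_act[of T p]
    by (auto simp: linear_iff Vector_Spaces.linear_iff scaleR_vec_def vector_scalar_mult_def
        scaleR_conv_of_real)
  then show ?thesis by (simp add: linear_conv_bounded_linear)
qed

lemma poly_act_commute: "poly_act T p (T *v v) = T *v poly_act T p v"
  using poly_act_mult[of T p "[:0, 1:]" v] poly_act_mult[of T "[:0, 1:]" p v]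
  by (simp add: mult.commute)

section \<open>The Cayley--Hamilton theorem\<close>

text \<open>The replaced determinants are the entries of the adjugate; this avoids minors, whose size
  would be a different type.\<close>

lemma sum_row_times_cofactor:
  fixes M :: "'a::comm_ring_1^'n^'n"
  shows "(\<Sum>j\<in>UNIV. M$i$j * det (\<chi> l. if l = k then axis j 1 else M$l)) = (if i = k then det M else 0)"
proof -
  have "(\<Sum>j\<in>UNIV. M$i$j * det (\<chi> l. if l = k then axis j 1 else M$l))
      = (\<Sum>j\<in>UNIV. det (\<chi> l. if l = k then M$i$j *s axis j 1 else M$l))"
    by (simp only: det_row_mul)
  also have "\<dots> = det (\<chi> l. if l = k then (\<Sum>j\<in>UNIV. M$i$j *s axis j 1) else M$l)"
    by (simp only: det_linear_row_sum[OF finite])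
  also have "\<dots> = det (\<chi> l. if l = k then M$i else M$l)"
    by (simp only: basis_expansion)
  also have "\<dots> = (if i = k then det M else 0)"
  proof (cases "i = k")
    case True
    then have "(\<chi> l. if l = k then M$i else M$l) = M" by (simp add: vec_eq_iff)
    with True show ?thesis by simp
  next
    case False
    then show ?thesis by (subst det_identical_rows[of i k]) (auto simp: row_def vec_eq_iff)
  qed
  finally show ?thesis .
qed

definition complex_vec :: "real^'n \<Rightarrow> complex^'n" where
  "complex_vec v = (\<chi> i. complex_of_real (v$i))"

definition complex_mat :: "real^'n^'m \<Rightarrow> complex^'n^'m" where
  "complex_mat M = (\<chi> i j. complex_of_real (M$i$j))"

text \<open>Let \<open>X\<close> act as \<open>A\<close>. The columns of \<open>X - A\<close> annihilate the vector of unit vectors, so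
  multiplying by the adjugate shows that the determinant of \<open>X - A\<close> annihilates every unit vector.\<close>

theorem cayley_hamilton:
  fixes A :: "real^'n^'n"
  shows "poly_act (complex_mat A) (char_polynomial A) v = 0"
proof -
  define T where "T = complex_mat A"
  define M :: "complex poly^'n^'n" where
    "M = (\<chi> i j. (if i = j then [:0, 1:] else 0) - [:complex_of_real (A $ i $ j):])"
  have col: "(\<Sum>i\<in>UNIV. poly_act T (M$i$j) (axis i 1)) = 0" for j
  proof -
    have "poly_act T (M$i$j) (axis i 1) = (if i = j then T *v axis j 1 else 0) - A$i$j *s axis i 1" for i
      by (simp add: M_def poly_act_diff)
    then have "(\<Sum>i\<in>UNIV. poly_act T (M$i$j) (axis i 1))
        = T *v axis j 1 - (\<Sum>i\<in>UNIV. A$i$j *s axis i 1)"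
      by (simp add: sum_subtractf)
    also have "(\<Sum>i\<in>UNIV. A$i$j *s axis i 1) = (\<Sum>i\<in>UNIV. ((T *v axis j 1)$i) *s axis i 1)"
    proof -
      have "(T *v axis j 1) $ i = A$i$j" for i
        by (simp add: T_def complex_mat_def matrix_vector_mult_def axis_def if_distrib cong: if_cong)
      then show ?thesis by simp
    qed
    also have "\<dots> = T *v axis j 1" by (rule basis_expansion)
    finally show ?thesis by simp
  qed
  have unit: "poly_act T (char_polynomial A) (axis k 1) = 0" for k
  proof -
    define c where "c j = det (\<chi> l. if l = k then axis j 1 else M $ l)" for j
    have "(\<Sum>j\<in>UNIV. c j * M$i$j) = (if i = k then det M else 0)" for i
      using sum_row_times_cofactor[of M i k] by (simp add: c_def mult.commute)
    then have "poly_act T (det M) (axis k 1) = (\<Sum>i\<in>UNIV. poly_act T (\<Sum>j\<in>UNIV. c j * M$i$j) (axis i 1))"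
      by (simp add: if_distrib[of "\<lambda>p. poly_act T p _"] cong: if_cong)
    also have "\<dots> = (\<Sum>i\<in>UNIV. \<Sum>j\<in>UNIV. poly_act T (c j) (poly_act T (M$i$j) (axis i 1)))"
      by (simp add: poly_act_sum poly_act_mult)
    \<comment> \<open>After the swap, the sum over \<open>i\<close> inside
      \<open>poly_act T (c j)\<close> is the column sum that vanishes by \<open>col\<close>.\<close>
    also have "\<dots> = (\<Sum>j\<in>UNIV. poly_act T (c j) (\<Sum>i\<in>UNIV. poly_act T (M$i$j) (axis i 1)))"
      by (subst sum.swap) (simp add: vec.linear_sum[OF linear_poly_act])
    also have "\<dots> = 0" by (simp add: col vec.linear_0[OF linear_poly_act])
    finally show ?thesis by (simp add: M_def char_polynomial_def)
  qed
  have "poly_act T (char_polynomial A) (\<Sum>k\<in>UNIV. (v$k) *s axis k 1) = 0"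
    by (simp add: vec.linear_sum[OF linear_poly_act] vec.linear_scale[OF linear_poly_act] unit)
  then show ?thesis by (simp add: basis_expansion T_def)
qed

lemma poly_det:
  "poly (det M) z = det (\<chi> i j. poly (M$i$j) z)" for M :: "'a::comm_ring_1 poly^'n^'n"
  by (simp add: det_def poly_sum poly_mult poly_prod)

section \<open>Norm-preserving passage from real to complex vectors\<close>

lemma complex_vec_component [simp]: "complex_vec v $ i = complex_of_real (v$i)"
  by (simp add: complex_vec_def)

lemma norm_complex_vec [simp]: "norm (complex_vec v) = norm v"
  by (simp add: norm_vec_def)

lemma complex_vec_0 [simp]: "complex_vec 0 = 0"
  by (simp add: vec_eq_iff)

lemma complex_vec_diff: "complex_vec (v - w) = complex_vec v - complex_vec w"
  by (simp add: vec_eq_iff)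

lemma complex_vec_matrix_mult: "complex_vec (M *v v) = complex_mat M *v complex_vec v"
  by (simp add: vec_eq_iff complex_mat_def matrix_vector_mult_def)

lemma complex_vec_funpow: "complex_vec (((*v) M ^^ i) v) = ((*v) (complex_mat M) ^^ i) (complex_vec v)"
  for M :: "real^'n^'n"
  by (induction i) (simp_all add: complex_vec_matrix_mult)

lemma norm_vector_smult: "norm (c *s v) = cmod c * norm v"
  by (simp add: norm_vec_def L2_set_right_distrib norm_mult)

section \<open>Stable and unstable factors\<close>

text \<open>A number \<open>z\<close> exceeding a norm bound of \<open>A\<close> makes
  \<open>z - A\<close> injective, so \<open>z\<close> is not a root.\<close>

lemma char_polynomial_nonzero: "char_polynomial A \<noteq> 0"
proof
  assume 0: "char_polynomial A = 0"
  define T where "T = complex_mat A"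
  obtain b where b: "b > 0" "\<And>v. norm (T *v v) \<le> b * norm v"
    using linear_bounded_pos[OF matrix_vector_mul_linear[of T]] by metis
  define z where "z = complex_of_real (b + 1)"
  define M where "M = mat z - T"
  have M: "M *v v = z *s v - T *v v" for v
    unfolding M_def matrix_vector_mult_diff_rdistrib
    by (simp add: vec_eq_iff mat_def matrix_vector_mult_def if_distrib if_distribR cong: if_cong)
  have "v = 0" if "M *v v = 0" for v
  proof -
    have "norm (T *v v) = (b + 1) * norm v"
      using that b(1) norm_vector_smult[of z v] by (simp add: M z_def)
    with b(2)[of v] have "norm v \<le> 0" by (simp add: algebra_simps)
    then show ?thesis by simp
  qed
  then have "\<exists>B. B ** M = mat 1" unfolding matrix_left_invertible_ker by blast
  then have "det M \<noteq> 0" by (simp flip: invertible_det_nz add: invertible_left_inverse)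
  also have "M = (\<chi> i j. poly ((if i = j then [:0, 1:] else 0) - [:complex_of_real (A $ i $ j):]) z)"
    by (simp add: vec_eq_iff M_def T_def complex_mat_def mat_def)
  also have "det \<dots> = poly (char_polynomial A) z"
    by (simp add: char_polynomial_def poly_det)
  finally show False by (simp add: 0)
qed

text \<open>The linear factors are sorted by the modulus of their roots. The leading coefficient
  joins \<open>s\<close> and leaves its roots unchanged.\<close>

lemma stable_unstable_factorization:
  fixes p :: "complex poly"
  assumes "p \<noteq> 0"
  obtains s u where "p = s * u" "u \<noteq> 0"
    "degree u = (\<Sum>z | poly p z = 0 \<and> 1 \<le> cmod z. order z p)"
    "\<And>z. poly s z = 0 \<Longrightarrow> cmod z < 1"
proof
  let ?f = "\<lambda>z. [:-z, 1:] ^ order z p"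
  let ?U = "{z. poly p z = 0 \<and> 1 \<le> cmod z}" and ?S = "{z. poly p z = 0 \<and> cmod z < 1}"
  have fin: "finite ?U" "finite ?S"
    using poly_roots_finite[OF assms] by (auto elim: rev_finite_subset)
  have "?S \<union> ?U = {z. poly p z = 0}" by auto
  then have "p = smult (lead_coeff p) (\<Prod>z\<in>?S \<union> ?U. ?f z)"
    by (simp only: complex_poly_decompose)
  also have "\<dots> = smult (lead_coeff p) (\<Prod>z\<in>?S. ?f z) * (\<Prod>z\<in>?U. ?f z)"
    by (subst prod.union_disjoint) (use fin in auto)
  finally show "p = smult (lead_coeff p) (\<Prod>z\<in>?S. ?f z) * (\<Prod>z\<in>?U. ?f z)" .
  show "(\<Prod>z\<in>?U. ?f z) \<noteq> 0" using fin by (simp add: prod_zero_iff)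
  show "degree (\<Prod>z\<in>?U. ?f z) = (\<Sum>z | poly p z = 0 \<and> 1 \<le> cmod z. order z p)"
    by (subst degree_prod_eq_sum_degree) (auto simp: degree_linear_power)
  show "cmod z < 1" if "poly (smult (lead_coeff p) (\<Prod>z\<in>?S. ?f z)) z = 0" for z
    using that assms fin by (auto simp: poly_prod prod_zero_iff)
qed

text \<open>\<open>d / (1 - r)\<close> is the fixed point of the map taking \<open>t\<close> to
  \<open>r * t + d\<close>, so each step preserves lying below it.\<close>

lemma stable_recurrence_bounded:
  fixes x :: "nat \<Rightarrow> real"
  assumes "0 \<le> r" "r < 1" "0 \<le> d" "x 0 \<le> 0"
    and "\<And>k. k < n \<Longrightarrow> x (Suc k) \<le> r * x k + d" and "k \<le> n"
  shows "x k \<le> d / (1 - r)"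
  using \<open>k \<le> n\<close>
proof (induction k)
  case 0
  have "0 \<le> d / (1 - r)" using assms by simp
  with assms(4) show ?case by linarith
next
  case (Suc k)
  have "x (Suc k) \<le> r * x k + d" using assms(5) Suc.prems by simp
  also have "\<dots> \<le> r * (d / (1 - r)) + d"
    using Suc assms(1) by (intro add_right_mono mult_left_mono) auto
  also have "\<dots> = d / (1 - r)" using assms(2) by (simp add: field_simps)
  finally show ?case .
qed

text \<open>Applying a linear factor \<open>T - z\<close> to the trajectory lowers the degree; the trajectory is then
  recovered by a scalar recurrence with factor \<open>z\<close>.\<close>

lemma stable_trajectories_bounded:
  fixes T :: "complex^'n^'n"
  assumes "p \<noteq> 0" "\<And>z. poly p z = 0 \<Longrightarrow> cmod z < 1"
  shows "\<exists>d. \<forall>n x. x 0 = 0 \<longrightarrow> (\<forall>k<n. norm (x (Suc k) - T *v x k) \<le> w) \<longrightarrow>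
    (\<forall>k\<le>n. poly_act T p (x k) = 0) \<longrightarrow> (\<forall>k\<le>n. norm (x k) \<le> d)"
  using assms
\<comment> \<open>\<open>w\<close> has to vary too: after a linear factor is applied, the
  disturbances are only bounded by \<open>w * b\<close>.\<close>
proof (induction "degree p" arbitrary: p w)
  case 0
  then obtain c where p: "p = [:c:]" "c \<noteq> 0" by (metis degree_eq_zeroE pCons_0_0)
  \<comment> \<open>A nonzero constant annihilates only the zero vector, so the bound 0
    works.\<close>
  then show ?case by (intro exI[of _ 0]) simp
next
  case (Suc m)
  then obtain z where z: "poly p z = 0"
    by (metis constant_degree fundamental_theorem_of_algebra nat.distinct(1))
  then obtain q where q: "p = [:-z, 1:] * q" by (auto simp: poly_eq_0_iff_dvd)
  have r: "cmod z < 1" using Suc.prems z by blast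
  have q0: "q \<noteq> 0" using q Suc.prems by auto
  have "degree p = Suc (degree q)" unfolding q using q0 by (subst degree_mult_eq) auto
  then have deg: "m = degree q" using Suc.hyps by simp
  have qz: "cmod y < 1" if "poly q y = 0" for y
    using Suc.prems(2)[of y] that by (simp add: q)
  define F where "F = poly_act T [:-z, 1:]"
  have F: "F v = T *v v - z *s v" for v by (simp add: F_def)
  have F_diff: "F (v - v') = F v - F v'" for v v'
    by (simp add: F_def vec.linear_diff[OF linear_poly_act])
  have F_T: "F (T *v v) = T *v F v" for v
    by (simp add: F_def poly_act_commute)
  obtain b where b: "b > 0" "\<And>v. norm (F v) \<le> norm v * b"
    using bounded_linear.pos_bounded[OF bounded_linear_poly_act, of T "[:-z, 1:]"] by (auto simp: F_def)
  obtain d where d: "\<And>n x k. x 0 = 0 \<Longrightarrow> (\<forall>k<n. norm (x (Suc k) - T *v x k) \<le> w * b) \<Longrightarrow>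
      (\<forall>k\<le>n. poly_act T q (x k) = 0) \<Longrightarrow> k \<le> n \<Longrightarrow> norm (x k) \<le> d"
    using Suc.hyps(1)[OF deg q0 qz, of "w * b"] by blast
  show ?case
  proof (intro exI allI impI)
    fix n x k
    assume x0: "x 0 = 0" and xs: "\<forall>k<n. norm (x (Suc k) - T *v x k) \<le> w"
      and xp: "\<forall>k\<le>n. poly_act T p (x k) = 0" and k: "k \<le> n"
    have "norm (F (x (Suc j)) - T *v F (x j)) \<le> w * b" if "j < n" for j
    proof -
      have "norm (F (x (Suc j)) - T *v F (x j)) \<le> norm (x (Suc j) - T *v x j) * b"
        using b(2)[of "x (Suc j) - T *v x j"] by (simp add: F_diff F_T)
      also have "\<dots> \<le> w * b" using xs that b(1) by simp
      finally show ?thesis .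
    qed
    moreover have "poly_act T q (F (x j)) = 0" if "j \<le> n" for j
      using xp that unfolding q F_def by (simp only: poly_act_mult[symmetric] mult.commute)
    moreover have "F (x 0) = 0" by (simp add: x0 F)
    ultimately have Fx: "norm (F (x j)) \<le> d" if "j \<le> n" for j
      using d[of "\<lambda>j. F (x j)" n j] that by blast
    \<comment> \<open>Absolute values supply the nonnegative constant that the scalar recurrence
      requires.\<close>
    have "norm (x (Suc j)) \<le> cmod z * norm (x j) + (\<bar>d\<bar> + \<bar>w\<bar>)" if "j < n" for j
    proof -
      have "x (Suc j) = z *s x j + (F (x j) + (x (Suc j) - T *v x j))"
        by (simp add: F)
      then have "norm (x (Suc j)) \<le> norm (z *s x j) + (norm (F (x j)) + norm (x (Suc j) - T *v x j))"
        by (metis norm_triangle_mono order_refl norm_triangle_ineq)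
      then show ?thesis using Fx[of j] xs that by (force simp: norm_vector_smult)
    qed
    then show "norm (x k) \<le> (\<bar>d\<bar> + \<bar>w\<bar>) / (1 - cmod z)"
      using r k by (intro stable_recurrence_bounded[where x = "\<lambda>k. norm (x k)" and n = n])
        (auto simp: x0)
  qed
qed

section \<open>Bounded observations\<close>

lemma bounded_sum_comp:
  fixes f :: "'i \<Rightarrow> 'a \<Rightarrow> 'b::real_normed_vector"
  assumes "\<And>i. i \<in> I \<Longrightarrow> bounded (f i ` S)"
  shows "bounded ((\<lambda>x. \<Sum>i\<in>I. f i x) ` S)"
  using assms
  by (induction I rule: infinite_finite_induct) (auto intro: bounded_plus_comp simp: image_constant_conv)

text \<open>Division with remainder by \<open>p\<close> reduces every power of \<open>T\<close> to powers below \<open>degree p\<close>, up to a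
  multiple of \<open>p\<close>.\<close>

lemma bounded_observations_all_powers:
  fixes T :: "complex^'n^'n" and F :: "complex^'n^'m"
  assumes "p \<noteq> 0" and p: "bounded (poly_act T p ` S)"
    and obs: "\<And>i. i < degree p \<Longrightarrow> bounded ((\<lambda>v. F *v ((*v) T ^^ i) v) ` S)"
  shows "bounded ((\<lambda>v. F *v ((*v) T ^^ i) v) ` S)"
proof -
  let ?d = "monom 1 i div p" and ?r = "monom 1 i mod p"
  have split: "F *v ((*v) T ^^ i) v = F *v poly_act T ?d (poly_act T p v)
      + (\<Sum>j\<le>degree ?r. coeff ?r j *s (F *v ((*v) T ^^ j) v))" for v
  proof -
    have "((*v) T ^^ i) v = poly_act T (?d * p + ?r) v"
      using poly_act_monom[of T 1 i v] by simp
    also have "\<dots> = poly_act T ?d (poly_act T p v) + (\<Sum>j\<le>degree ?r. coeff ?r j *s ((*v) T ^^ j) v)"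
      by (subst poly_act_add) (simp only: poly_act_mult poly_act_def[of T ?r])
    finally show ?thesis
      by (simp add: matrix_vector_right_distrib vector_scalar_commute
          vec.linear_sum[OF matrix_vector_mul_linear_gen])
  qed
  have "bounded ((\<lambda>v. F *v poly_act T ?d (poly_act T p v)) ` S)"
    using bounded_linear_image[OF p bounded_linear_compose[OF matrix_vector_mul_bounded_linear
          bounded_linear_poly_act], of F T ?d] by (simp add: image_image)
  moreover have "bounded ((\<lambda>v. coeff ?r j *s (F *v ((*v) T ^^ j) v)) ` S)" for j
  proof (cases "j < degree p")
    case True
    \<comment> \<open>Scaling is the action of a constant polynomial; the zero matrix is an
      arbitrary choice.\<close>
    have "bounded_linear (\<lambda>v :: complex^'m. coeff ?r j *s v)"
      using bounded_linear_poly_act[of "mat 0" "[:coeff ?r j:]"] by (simp add: poly_act_pCons[abs_def])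
    from bounded_linear_image[OF obs[OF True] this] show ?thesis by (simp add: image_image)
  next
    \<comment> \<open>This includes a constant \<open>p\<close>: the remainder is 0, yet the sum
      still has the index 0.\<close>
    case False
    then have "coeff ?r j = 0"
      using degree_mod_less[OF \<open>p \<noteq> 0\<close>, of "monom 1 i"] by (auto intro: coeff_eq_0)
    then show ?thesis by (simp add: image_constant_conv)
  qed
  ultimately show ?thesis
    unfolding split by (intro bounded_plus_comp bounded_sum_comp)
qed

lemma mat_pow_mult_vec: "mat_pow A i *v v = ((*v) A ^^ i) v"
  by (induction i) (simp_all add: matrix_vector_mul_assoc[symmetric])

text \<open>The vectors whose inner products with \<open>S\<close> stay bounded form a subspace. It
  contains the observability rows, which span the whole space, hence also the unit vectors.\<close>

lemma bounded_if_observations_bounded: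
  fixes A :: "real^'n^'n" and C :: "real^'n^'p"
  assumes rank: "observability_rank A C s = CARD('n)"
    and obs: "\<And>i. i < s \<Longrightarrow> bounded ((\<lambda>v. C *v ((*v) A ^^ i) v) ` S)"
  shows "bounded S"
proof -
  let ?R = "\<Union>j<s. rows (C ** mat_pow A j)"
  define V where "V = {x :: real^'n. bounded ((\<lambda>v. x \<bullet> v) ` S)}"
  have "subspace V"
    unfolding subspace_def V_def
    by (auto simp: inner_add_left image_constant_conv intro: bounded_plus_comp)
      (use bounded_scaleR_comp in fastforce)
  moreover have "?R \<subseteq> V"
  proof clarify
    fix j x assume "j < s" "x \<in> rows (C ** mat_pow A j)"
    then obtain i where x: "x = row i (C ** mat_pow A j)" by (auto simp: rows_def)
    have "x \<bullet> v = (C *v ((*v) A ^^ j) v) $ i" for v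
    proof -
      have "x \<bullet> v = ((C ** mat_pow A j) *v v) $ i"
        by (simp add: x row_def inner_vec_def matrix_vector_mult_def)
      then show ?thesis by (simp add: matrix_vector_mul_assoc[symmetric] mat_pow_mult_vec)
    qed
    moreover have "bounded ((\<lambda>v. (C *v ((*v) A ^^ j) v) $ i) ` S)"
      using bounded_linear_image[OF obs[OF \<open>j < s\<close>] bounded_linear_vec_nth[of i]]
      by (simp add: image_image)
    ultimately show "x \<in> V" by (simp add: V_def)
  qed
  ultimately have "span ?R \<subseteq> V" by (simp add: span_minimal)
  moreover have "span ?R = UNIV"
    using rank by (simp add: observability_rank_def flip: dim_eq_full)
  ultimately have "bounded ((\<lambda>v. axis i 1 \<bullet> v) ` S)" for i
    by (auto simp: V_def)
  then have "bounded ((\<lambda>v. v $ i) ` S)" for i by (simp add: inner_axis')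
  then have "\<forall>i. \<exists>d. \<forall>v\<in>S. \<bar>v $ i\<bar> \<le> d" by (simp add: bounded_iff)
  then obtain d where d: "\<And>i v. v \<in> S \<Longrightarrow> \<bar>v $ i\<bar> \<le> d i" by metis
  have "norm v \<le> (\<Sum>i\<in>UNIV. d i)" if "v \<in> S" for v
    by (rule order_trans[OF norm_le_l1_cart sum_mono]) (rule d[OF that])
  then show ?thesis by (auto simp: bounded_iff)
qed

text \<open>Each of the \<open>m\<close> disturbances is amplified by at most \<open>g ^ m\<close>,
  because \<open>g\<close> is at least 1.\<close>

lemma iterate_deviation:
  fixes A :: "real^'n^'n"
  assumes g: "1 \<le> g" "\<And>v. norm (A *v v) \<le> g * norm v"
    and "0 \<le> w" "\<And>i. i < m \<Longrightarrow> norm (x (Suc (k + i)) - A *v x (k + i)) \<le> w"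
  shows "norm (x (k + m) - ((*v) A ^^ m) (x k)) \<le> g ^ m * (real m * w)"
  using assms(4)
proof (induction m)
  case (Suc m)
  have "x (k + Suc m) - ((*v) A ^^ Suc m) (x k)
      = A *v (x (k + m) - ((*v) A ^^ m) (x k)) + (x (Suc (k + m)) - A *v x (k + m))"
    by (simp add: matrix_vector_mult_diff_distrib)
  then have "norm (x (k + Suc m) - ((*v) A ^^ Suc m) (x k))
      \<le> norm (A *v (x (k + m) - ((*v) A ^^ m) (x k))) + norm (x (Suc (k + m)) - A *v x (k + m))"
    by (metis norm_triangle_ineq)
  also have "\<dots> \<le> g * (g ^ m * (real m * w)) + w"
    using Suc by (intro add_mono order_trans[OF g(2)] mult_left_mono) (use g(1) in auto)
  also have "\<dots> \<le> g * (g ^ m * (real m * w)) + g ^ Suc m * w"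
    using g(1) \<open>0 \<le> w\<close> one_le_power[OF g(1), of "Suc m"] by (simp add: mult_right_mono[of 1 "g ^ Suc m" w, simplified])
  also have "\<dots> = g ^ Suc m * (real (Suc m) * w)" by (simp add: algebra_simps)
  finally show ?case .
qed simp

lemma norm_iterate_le:
  fixes A :: "real^'n^'n"
  assumes "0 \<le> g" "\<And>v. norm (A *v v) \<le> g * norm v"
  shows "norm (((*v) A ^^ m) v) \<le> g ^ m * norm v"
proof (induction m)
  case (Suc m)
  have "norm (A *v ((*v) A ^^ m) v) \<le> g * (g ^ m * norm v)"
    using assms(1) Suc by (intro order_trans[OF assms(2)] mult_left_mono)
  then show ?case by (simp add: mult.assoc)
qed simp

text \<open>A factor of at least 1 has powers that increase with the exponent.\<close>

lemma linear_bound_ge_1: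
  fixes f :: "'a::euclidean_space \<Rightarrow> 'b::real_normed_vector"
  assumes "linear f"
  obtains g where "1 \<le> g" "\<And>v. norm (f v) \<le> g * norm v"
proof -
  obtain b where b: "b > 0" "\<And>v. norm (f v) \<le> b * norm v"
    using linear_bounded_pos[OF assms] by metis
  have "norm (f v) \<le> (b + 1) * norm v" for v
    using b(2)[of v] norm_ge_zero[of v] by (simp only: distrib_right mult_1)
  with b(1) that[of "b + 1"] show ?thesis by simp
qed

section \<open>Attacks under intermittent enforcement\<close>

text \<open>Expressing the attack through the residue cancels the term \<open>K C A\<close>. What
  remains is \<open>A\<close> driven by an input that stealthiness bounds.\<close>

lemma error_change_residue:
  "error_change A C K a (Suc k) = A *v error_change A C K a k - K *v residue_change A C K a (Suc k)"
  by (simp add: residue_change_def matrix_vector_mult_diff_rdistrib matrix_vector_right_distrib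
      matrix_vector_mul_assoc matrix_mul_assoc)

lemma outer_component [simp]: "outer e $ i $ j = e $ i * e $ j"
  by (simp add: outer_def matrix_matrix_mult_def columnvector_def rowvector_def)

text \<open>Testing the matrix inequality on the unit vectors bounds every coordinate of \<open>e\<close>.\<close>

lemma bounded_outer_le:
  fixes M :: "real^'n^'n" and T :: "(real^'n) set"
  assumes "bounded T" and le: "\<And>e. e \<in> S \<Longrightarrow> \<exists>d\<in>T. outer e \<preceq>\<^sub>L outer d + M"
  shows "bounded S"
proof -
  obtain b where b: "\<And>d. d \<in> T \<Longrightarrow> norm d \<le> b" using assms(1) by (auto simp: bounded_iff)
  have coord: "\<bar>e $ i\<bar> \<le> b\<^sup>2 + \<bar>M$i$i\<bar> + 1" if "e \<in> S" for e i
  proof -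
    obtain d where d: "d \<in> T" "outer e \<preceq>\<^sub>L outer d + M" using le \<open>e \<in> S\<close> by blast
    have "0 \<le> axis i 1 \<bullet> ((outer d + M - outer e) *v axis i 1)"
      using d(2) by (simp add: loewner_le_def pos_semidef_def)
    then have "(e $ i)\<^sup>2 \<le> (d $ i)\<^sup>2 + M$i$i"
      by (simp add: matrix_vector_mult_diff_rdistrib matrix_vector_mult_add_rdistrib inner_diff_right
          inner_add_right inner_axis' matrix_vector_mult_basis column_def power2_eq_square)
    also have "(d $ i)\<^sup>2 \<le> b\<^sup>2"
      using component_le_norm_cart[of d i] b[OF d(1)] by (intro abs_le_square_iff[THEN iffD1]) simp
    finally have "(e $ i)\<^sup>2 \<le> b\<^sup>2 + \<bar>M$i$i\<bar>" by simp
    \<comment> \<open>This bounds a coordinate by its square plus 1 without taking a root.\<close>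
    moreover have "0 \<le> (\<bar>e $ i\<bar> - 1)\<^sup>2" by simp
    then have "\<bar>e $ i\<bar> \<le> (e $ i)\<^sup>2 + 1" by (simp add: power2_eq_square algebra_simps)
    ultimately show ?thesis by linarith
  qed
  have "norm e \<le> (\<Sum>i\<in>UNIV. b\<^sup>2 + \<bar>M$i$i\<bar> + 1)" if "e \<in> S" for e
    by (rule order_trans[OF norm_le_l1_cart sum_mono]) (rule coord[OF that])
  then show ?thesis by (auto simp: bounded_iff)
qed

lemma policy_gap:
  assumes "policy_schedule \<mu> (enat l)"
  shows "\<mu> (Suc k) \<le> \<mu> k + l"
proof -
  have "enat (\<mu> (Suc k) - \<mu> (Suc k - 1)) \<le> (SUP k\<in>{0<..}. enat (\<mu> k - \<mu> (k - 1)))"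
    by (rule SUP_upper) simp
  with assms have "enat (\<mu> (Suc k) - \<mu> k) \<le> enat l" by (simp add: policy_schedule_def)
  then show ?thesis by simp
qed

text \<open>The factor of the characteristic polynomial with the stable roots annihilates \<open>u\<close> applied to
  the errors, where \<open>u\<close> is the factor with the unstable roots.\<close>

lemma unstable_factor_bounded:
  fixes A :: "real^'n^'n"
  assumes "char_polynomial A = s * u" "\<And>z. poly s z = 0 \<Longrightarrow> cmod z < 1"
  shows "\<exists>d. \<forall>n x. x 0 = 0 \<longrightarrow> (\<forall>k<n. norm (x (Suc k) - A *v x k) \<le> w) \<longrightarrow>
    (\<forall>k\<le>n. norm (poly_act (complex_mat A) u (complex_vec (x k))) \<le> d)"
proof -
  define T where "T = complex_mat A"
  define F where "F v = poly_act T u (complex_vec v)" for v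
  obtain b where b: "b > 0" "\<And>v. norm (poly_act T u v) \<le> norm v * b"
    using bounded_linear.pos_bounded[OF bounded_linear_poly_act] by blast
  have s0: "s \<noteq> 0" using assms(1) char_polynomial_nonzero[of A] by auto
  obtain d where d: "\<And>n x k. x 0 = 0 \<Longrightarrow> (\<forall>k<n. norm (x (Suc k) - T *v x k) \<le> w * b) \<Longrightarrow>
      (\<forall>k\<le>n. poly_act T s (x k) = 0) \<Longrightarrow> k \<le> n \<Longrightarrow> norm (x k) \<le> d"
    using stable_trajectories_bounded[OF s0 assms(2), of T "w * b"] by blast
  have "norm (F (x k)) \<le> d"
    if x: "x 0 = 0" "\<forall>k<n. norm (x (Suc k) - A *v x k) \<le> w" and "k \<le> n" for n x k
  proof (rule d[of "\<lambda>k. F (x k)"])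
    show "F (x 0) = 0" by (simp add: F_def x(1) vec.linear_0[OF linear_poly_act])
    have "norm (F (x (Suc k)) - T *v F (x k)) \<le> w * b" if "k < n" for k
    proof -
      have "F (x (Suc k)) - T *v F (x k) = poly_act T u (complex_vec (x (Suc k) - A *v x k))"
        by (simp add: F_def T_def complex_vec_diff complex_vec_matrix_mult
            vec.linear_diff[OF linear_poly_act] poly_act_commute)
      also have "norm \<dots> \<le> norm (x (Suc k) - A *v x k) * b" using b(2) by (metis norm_complex_vec)
      also have "\<dots> \<le> w * b" using x(2) that b(1) by simp
      finally show ?thesis .
    qed
    then show "\<forall>k<n. norm (F (x (Suc k)) - T *v F (x k)) \<le> w * b" by blast
    show "\<forall>k\<le>n. poly_act T s (F (x k)) = 0"
      unfolding F_def T_def by (simp flip: poly_act_mult assms(1) add: cayley_hamilton)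
  qed fact
  then show ?thesis unfolding F_def T_def by blast
qed

lemma bounded_complex_vec_image:
  "bounded ((\<lambda>v. complex_vec (f v)) ` S) \<longleftrightarrow> bounded (f ` S)"
  by (simp add: bounded_iff)

text \<open>The cases follow which number attains the minimum. Only \<open>A v\<close> is recovered,
  since the first enforced residue already sees the previous error through
  \<open>C A\<close>.\<close>

lemma bounded_after_observations:
  fixes A :: "real^'n^'n" and C :: "real^'n^'p"
  assumes "observable A C"
    and u: "u \<noteq> 0" "bounded ((\<lambda>v. poly_act (complex_mat A) u (complex_vec v)) ` S)"
    and obs: "\<And>i. i < min (observability_index A C) (degree u) \<Longrightarrow>
      bounded ((\<lambda>v. C *v ((*v) A ^^ i) (A *v v)) ` S)"
  shows "bounded ((*v) A ` S)"
proof (cases "observability_index A C \<le> degree u")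
  case True
  have "observability_rank A C (observability_index A C) = CARD('n)"
    using assms(1) unfolding observable_def observability_index_def by (rule LeastI)
  then show ?thesis
    by (rule bounded_if_observations_bounded) (use obs True in \<open>auto simp: image_image\<close>)
next
  case False
  let ?T = "complex_mat A" and ?S = "(\<lambda>v. complex_vec (A *v v)) ` S"
  \<comment> \<open>The bound on \<open>u(A)\<close> passes from \<open>v\<close> to
    \<open>A v\<close> because \<open>u(A)\<close> commutes with \<open>A\<close>.\<close>
  have "bounded (poly_act ?T u ` ?S)"
    using bounded_linear_image[OF u(2) matrix_vector_mul_bounded_linear, of ?T]
    by (simp add: image_image complex_vec_matrix_mult poly_act_commute)
  moreover have eq: "complex_mat C *v ((*v) ?T ^^ i) (complex_vec v) = complex_vec (C *v ((*v) A ^^ i) v)"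
    for i v by (simp add: complex_vec_matrix_mult complex_vec_funpow)
  have "bounded ((\<lambda>v. complex_mat C *v ((*v) ?T ^^ i) v) ` ?S)" if "i < degree u" for i
    using obs[of i] that False by (simp add: image_image eq bounded_complex_vec_image)
  ultimately have "bounded ((\<lambda>v. complex_mat C *v ((*v) ?T ^^ i) v) ` ?S)" for i
    by (rule bounded_observations_all_powers[OF u(1)])
  then have "bounded ((\<lambda>v. C *v ((*v) A ^^ i) v) ` (*v) A ` S)" for i
    by (simp add: image_image eq bounded_complex_vec_image)
  \<comment> \<open>All powers are now available, so the full rank at \<open>CARD('n)\<close>
    applies.\<close>
  with assms(1) show ?thesis
    unfolding observable_def by (rule bounded_if_observations_bounded)
qed

text \<open>The bound has to be uniform over all attacks and all horizons \<open>n\<close>.\<close>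

lemma errors_bounded:
  fixes A :: "real^'n^'n" and C :: "real^'n^'p" and K :: "real^'p^'n"
  assumes "observable A C" and \<mu>: "policy_schedule \<mu> (enat l)"
    and f: "f = min (observability_index A C) (num_unstable_eigenvalues A)"
  shows "bounded {error_change A C K a n | a n. a \<in> stealthy_attacks A C K \<K> \<mu> f n}"
proof -
  let ?e = "error_change A C K"
  let ?St = "stealthy_attacks A C K \<K> \<mu> f"
  obtain s u where su: "char_polynomial A = s * u" "u \<noteq> 0" "degree u = num_unstable_eigenvalues A"
    "\<And>z. poly s z = 0 \<Longrightarrow> cmod z < 1"
    using stable_unstable_factorization[OF char_polynomial_nonzero[of A]]
    unfolding num_unstable_eigenvalues_def by metis
  obtain g where g: "1 \<le> g" "\<And>v. norm (A *v v) \<le> g * norm v"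
    using linear_bound_ge_1[OF matrix_vector_mul_linear[of A]] by blast
  obtain w where w: "1 \<le> w" "\<And>v. norm (K *v v) \<le> w * norm v"
    using linear_bound_ge_1[OF matrix_vector_mul_linear[of K]] by blast
  have step: "norm (?e a (Suc k) - A *v ?e a k) \<le> w" if "a \<in> ?St n" "k < n" for a k n
  proof -
    have "norm (residue_change A C K a (Suc k)) \<le> 1"
      using that by (simp add: stealthy_attacks_def)
    then have "w * norm (residue_change A C K a (Suc k)) \<le> w * 1"
      using w(1) by (intro mult_left_mono) auto
    with w(2)[of "residue_change A C K a (Suc k)"] show ?thesis
      by (simp add: error_change_residue del: error_change.simps)
  qed
  have dev: "norm (?e a (k + m) - ((*v) A ^^ m) (?e a k)) \<le> g ^ m * (real m * w)"
    if "a \<in> ?St n" "k + m \<le> n" for a k m n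
    by (rule iterate_deviation[OF g]) (use w(1) step[OF that(1)] that(2) in \<open>auto simp del: error_change.simps\<close>)
  \<comment> \<open>Errors one step before a block that ends within the horizon, so that
    stealthiness constrains every residue of the block.\<close>
  define S where "S = {?e a (\<mu> j - 1) | a j n. a \<in> ?St n \<and> \<mu> j + f \<le> n}"
  have \<mu>_pos: "1 < \<mu> j" for j
    using \<mu> by (metis less_le_trans policy_schedule_def strict_mono_less_eq zero_le)
  have "bounded ((*v) A ` S)"
  proof (rule bounded_after_observations[OF assms(1) su(2)])
    obtain d where "\<And>a n k. a \<in> ?St n \<Longrightarrow> k \<le> n \<Longrightarrow>
        norm (poly_act (complex_mat A) u (complex_vec (?e a k))) \<le> d"
      using unstable_factor_bounded[OF su(1) su(4), of w] step error_change.simps(1) by metis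
    then show "bounded ((\<lambda>v. poly_act (complex_mat A) u (complex_vec v)) ` S)"
      unfolding S_def bounded_iff by (intro exI[of _ d]) auto
    fix i assume "i < min (observability_index A C) (degree u)"
    then have i: "i < f" by (simp add: f su(3))
    obtain c where c: "1 \<le> c" "\<And>v. norm ((C ** A) *v v) \<le> c * norm v"
      using linear_bound_ge_1[OF matrix_vector_mul_linear[of "C ** A"]] by blast
    have "norm (C *v ((*v) A ^^ i) (A *v ?e a (\<mu> j - 1))) \<le> 1 + c * (g ^ i * (real i * w))"
      if a: "a \<in> ?St n" "\<mu> j + f \<le> n" for a j n
    proof -
      define k where "k = \<mu> j - 1"
      have k: "Suc (k + i) = \<mu> j + i" using \<mu>_pos[of j] by (simp add: k_def)
      define v where "v = (C ** A) *v ?e a (k + i)"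
      have "Suc (k + i) \<in> {1..n}" using k i a(2) by auto
      moreover have "Suc (k + i) \<in> enforced_times \<mu> f"
        unfolding k enforced_times_def using i by blast
      ultimately have "a (Suc (k + i)) = 0" "norm (residue_change A C K a (Suc (k + i))) \<le> 1"
        using a(1) unfolding stealthy_attacks_def mem_Collect_eq by blast+
      then have v: "norm v \<le> 1" by (simp add: residue_change_def v_def)
      \<comment> \<open>The error inside the block is compared with the free evolution from time
        \<open>k\<close>; \<open>dev\<close> bounds the difference.\<close>
      have "C *v ((*v) A ^^ i) (A *v ?e a k) = v - (C ** A) *v (?e a (k + i) - ((*v) A ^^ i) (?e a k))"
        by (simp add: v_def matrix_vector_mult_diff_distrib funpow_swap1 flip: matrix_vector_mul_assoc)
      also have "norm \<dots> \<le> norm v + norm ((C ** A) *v (?e a (k + i) - ((*v) A ^^ i) (?e a k)))"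
        by (rule norm_triangle_ineq4)
      also have "\<dots> \<le> 1 + c * (g ^ i * (real i * w))"
        using v dev[OF a(1), of k i] k i a(2) c(1)
        by (intro add_mono order_trans[OF c(2)] mult_left_mono) auto
      finally show ?thesis by (simp add: k_def)
    qed
    then show "bounded ((\<lambda>v. C *v ((*v) A ^^ i) (A *v v)) ` S)"
      unfolding S_def bounded_iff by (intro exI[of _ "1 + c * (g ^ i * (real i * w))"]) auto
  qed
  then obtain d where "\<forall>v\<in>S. norm (A *v v) \<le> d"
    unfolding bounded_iff by auto
  moreover have "?e a (\<mu> j - 1) \<in> S" if "a \<in> ?St n" "\<mu> j + f \<le> n" for a j n
    unfolding S_def using that by blast
  ultimately have d: "norm (A *v ?e a (\<mu> j - 1)) \<le> d" if "a \<in> ?St n" "\<mu> j + f \<le> n" for a j n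
    using that by blast
  \<comment> \<open>Long enough both for the stretch before the first block is completed and for the
    one from a completed block to the end of the next.\<close>
  let ?m = "\<mu> 0 + l + f"
  have grow: "norm (?e a (k + m)) \<le> g ^ ?m * (r + real ?m * w)"
    if "a \<in> ?St (k + m)" "m \<le> ?m" "norm (?e a k) \<le> r" for a k m r
  proof -
    have "norm (?e a (k + m)) \<le> norm (((*v) A ^^ m) (?e a k)) + norm (?e a (k + m) - ((*v) A ^^ m) (?e a k))"
      by (rule norm_triangle_sub)
    also have "\<dots> \<le> g ^ m * norm (?e a k) + g ^ m * (real m * w)"
      using dev[OF that(1) order_refl] norm_iterate_le[of g A m "?e a k"] g by (intro add_mono) auto
    also have "\<dots> = g ^ m * (norm (?e a k) + real m * w)" by (simp add: distrib_left)
    also have "\<dots> \<le> g ^ ?m * (r + real ?m * w)"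
      using g(1) w(1) that by (intro mult_mono power_increasing add_mono mult_right_mono) auto
    finally show ?thesis .
  qed
  have "norm (?e a n) \<le> g ^ ?m * (\<bar>d\<bar> + w + real ?m * w)" if a: "a \<in> ?St n" for a n
  proof (cases "\<mu> 0 + f \<le> n")
    case False
    \<comment> \<open>Before the first block is completed, growth starts from the zero error at time
      0.\<close>
    then show ?thesis using grow[of a 0 n "\<bar>d\<bar> + w"] a w(1) by simp
  next
    case True
    let ?J = "{j. \<mu> j + f \<le> n}"
    have \<mu>_ge: "i \<le> \<mu> i" for i
      using \<mu> by (simp add: policy_schedule_def strict_mono_imp_increasing)
    have "?J \<subseteq> {..n}"
    proof
      fix i assume "i \<in> ?J"
      with \<mu>_ge[of i] show "i \<in> {..n}" by simp
    qed
    then have fin: "finite ?J" by (rule finite_subset) simp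
    \<comment> \<open>The last block completed by time \<open>n\<close>; the next one ends later,
      which limits \<open>n - \<mu> j\<close>.\<close>
    define j where "j = Max ?J"
    have j: "\<mu> j + f \<le> n" using Max_in[OF fin] True unfolding j_def by blast
    have "\<mu> (Suc j) + f > n"
      using Max_ge[OF fin, of "Suc j"] unfolding j_def[symmetric] by fastforce
    with policy_gap[OF \<mu>, of j] have gap: "n - \<mu> j \<le> ?m" by linarith
    \<comment> \<open>\<open>d\<close> controls \<open>A\<close> times the error at
      \<open>\<mu> j - 1\<close>; one disturbance \<open>w\<close> leads to time
      \<open>\<mu> j\<close>.\<close>
    have "norm (?e a (\<mu> j)) \<le> norm (A *v ?e a (\<mu> j - 1)) + norm (?e a (\<mu> j) - A *v ?e a (\<mu> j - 1))"
      by (rule norm_triangle_sub)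
    also have "\<dots> \<le> \<bar>d\<bar> + w"
    proof -
      have "\<mu> j - 1 < n" "Suc (\<mu> j - 1) = \<mu> j" using j \<mu>_pos[of j] by linarith+
      with d[OF a j] step[OF a, of "\<mu> j - 1"] show ?thesis by simp
    qed
    finally show ?thesis using grow[of a "\<mu> j" "n - \<mu> j"] a gap j by simp
  qed
  then show ?thesis
    unfolding bounded_iff by (intro exI[of _ "g ^ ?m * (\<bar>d\<bar> + w + real ?m * w)"]) auto
qed

theorem theorem4:
  fixes A :: "real^'n^'n" and C :: "real^'n^'p" and K :: "real^'p^'n"
    and Q \<Sigma> :: "real^'n^'n" and R :: "real^'p^'p"
    and \<gamma> :: real and \<K> :: "'p set"
    and \<mu> :: "nat \<Rightarrow> nat" and f :: nat and L :: enat
  assumes "observable A C"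
    and "steady_state_kalman A C Q R \<Sigma>"
    and "K = kalman_gain C R \<Sigma>"
    and "\<gamma> \<ge> 0"
    and "policy_schedule \<mu> L"
    and "f = min (observability_index A C) (num_unstable_eigenvalues A)"
    and "L < \<infinity>"
  shows "\<not> perfectly_attackable A C K \<Sigma> \<gamma> \<K> \<mu> f"
proof -
  obtain l where "L = enat l" using \<open>L < \<infinity>\<close> by (cases L) auto
  with errors_bounded[of A C \<mu> l f] assms
  have "bounded {error_change A C K a n | a n. a \<in> stealthy_attacks A C K \<K> \<mu> f n}" by blast
  \<comment> \<open>Every reachable vector is dominated by the error of a stealthy attack, up to the
    fixed matrix \<open>\<gamma> *\<^sub>R \<Sigma>\<close>.\<close>
  then have "bounded (reachable_region A C K \<Sigma> \<gamma> \<K> \<mu> f)"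
    by (rule bounded_outer_le[where M = "\<gamma> *\<^sub>R \<Sigma>"])
      (auto simp: reachable_region_def reachable_at_def)
  then show ?thesis by (simp add: perfectly_attackable_def)
qed

end
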